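(* Let $\mathbf{S}=(S,+,\cdot,0,1)\in\mathcal{V}$ with $1+1\neq 1$ in $\mathbf{S}$, let $n\in\mathbb{N}_0$, and let $t(x_1,\ldots,x_n)$ and $u(x_1,\ldots,x_n)$ be terms in the language $(+,\cdot,0,1)$. If $\mathbf{S}\models t(x_1,\ldots,x_n)\approx u(x_1,\ldots,x_n)$, then $\mathcal{V}\models t(x_1,\ldots,x_n)\approx u(x_1,\ldots,x_n)$.
   Context: A semiring is an algebra $\mathbf{S}=(S,+,\cdot,0,1)$ of type $(2,2,0,0)$ such that $(S,+,0)$ is a commutative monoid, $(S,\cdot,1)$ is a monoid, $\cdot$ distributes over $+$ (on both sides), and $x0=0x=0$ for all $x\in S$. It is commutative if $\cdot$ is commutative and multiplicatively idempotent if $xx=x$ for all $x\in S$. $\mathcal{V}$ denotes the variety of all commutative multiplicatively idempotent semirings satisfying the identity $x+y+xyz\approx x+y$. For an algebra $\mathbf{S}$ and terms $t,u$, $\mathbf{S}\models t\approx u$ means that $t$ and $u$ take the same value in $\mathbf{S}$ under every assignment of elements of $S$ to the variables; $\mathcal{V}\models t\approx u$ means that this holds in every member of $\mathcal{V}$. $\mathbb{N}_0$ is the set of non-negative integers. *)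

theory Defs
  imports "HOL-Algebra.Ring"
begin

text \<open>
  A semiring with 0 and 1 as in universal algebra is exactly the locale \<open>semiring\<close>
  of \<open>HOL-Algebra\<close>; in particular the trivial semiring (with 0 = 1) is allowed.
\<close>

locale comm_mult_idem_semiring = semiring R + comm_monoid R for R (structure) +
  assumes mult_idem: "x \<in> carrier R \<Longrightarrow> x \<otimes> x = x"

locale semiring_in_V = comm_mult_idem_semiring +
  assumes V_identity:
    "\<lbrakk>x \<in> carrier R; y \<in> carrier R; z \<in> carrier R\<rbrakk> \<Longrightarrow>
      x \<oplus> y \<oplus> x \<otimes> y \<otimes> z = x \<oplus> y"

datatype (vars: 'v) sr_term =
    Var 'v
  | Zero
  | One
  | Add "'v sr_term" "'v sr_term"
  | Mult "'v sr_term" "'v sr_term"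

primrec term_value :: "('a, 'm) ring_scheme \<Rightarrow> ('v \<Rightarrow> 'a) \<Rightarrow> 'v sr_term \<Rightarrow> 'a" where
  "term_value R \<rho> (Var v) = \<rho> v"
| "term_value R \<rho> Zero = \<zero>\<^bsub>R\<^esub>"
| "term_value R \<rho> One = \<one>\<^bsub>R\<^esub>"
| "term_value R \<rho> (Add t u) = term_value R \<rho> t \<oplus>\<^bsub>R\<^esub> term_value R \<rho> u"
| "term_value R \<rho> (Mult t u) = term_value R \<rho> t \<otimes>\<^bsub>R\<^esub> term_value R \<rho> u"

definition satisfies_identity ::
    "('a, 'm) ring_scheme \<Rightarrow> 'v sr_term \<Rightarrow> 'v sr_term \<Rightarrow> bool"
    (\<open>(_ \<Turnstile> _ \<approx> _)\<close> [51, 51, 51] 50) where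
  "(R \<Turnstile> t \<approx> u) \<longleftrightarrow>
    (\<forall>\<rho>. (\<forall>v. \<rho> v \<in> carrier R) \<longrightarrow> term_value R \<rho> t = term_value R \<rho> u)"

end

theory Submission
  imports Defs "HOL-Library.Multiset"
begin

text \<open>
  Every term is a sum of monomials, and by idempotence a monomial is a finite set of variables.
  Evaluating a term at the indicator of \<open>Z\<close> inside \<open>S\<close> yields \<open>0\<close>, \<open>1\<close> or \<open>1 + 1\<close>, and these
  are pairwise distinct, so the identity in \<open>S\<close> determines the number of monomials contained in \<open>Z\<close>
  up to truncation at 2. Conversely, if at least two monomials of a sum are contained in \<open>p\<close>, then
  \<open>x + y + xyz = x + y\<close> lets the sum absorb \<open>p\<close>. The monomials \<open>p\<close> of a sum that contain
  no monomial of it besides \<open>p\<close> itself (counted with multiplicity) are determined by the truncated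
  counts. Hence two sums with equal truncated counts share these, and each absorbs the remaining
  monomials of the other.
\<close>

section \<open>Counting monomials contained in a set\<close>

definition count_below :: "'v set list \<Rightarrow> 'v set \<Rightarrow> nat" where
  "count_below xs Z = length (filter (\<lambda>p. p \<subseteq> Z) xs)"

lemma count_below_simps [simp]:
  "count_below [] Z = 0"
  "count_below (p # xs) Z = (if p \<subseteq> Z then Suc (count_below xs Z) else count_below xs Z)"
  by (simp_all add: count_below_def)

lemma count_below_eq_0_iff: "count_below xs Z = 0 \<longleftrightarrow> (\<forall>p\<in>set xs. \<not> p \<subseteq> Z)"
  by (simp add: count_below_def filter_empty_conv)

lemma count_le_count_below: "count (mset xs) p \<le> count_below xs p"
  by (induction xs) auto

text \<open>An entry \<open>p\<close> of \<open>xs\<close> counts itself, so the value 1 means that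
  no other entry, not even a second copy of \<open>p\<close>, is contained in
  \<open>p\<close>.\<close>

definition isolated :: "'v set list \<Rightarrow> 'v set list" where
  "isolated xs = filter (\<lambda>p. count_below xs p = 1) xs"

text \<open>A repeated entry would count itself twice. With this, the sum over
  \<open>isolated xs\<close> depends only on the underlying set.\<close>

lemma distinct_isolated: "distinct (isolated xs)"
proof -
  have "count (mset (isolated xs)) p = (if p \<in> set (isolated xs) then 1 else 0)" for p
  proof (cases "p \<in> set (isolated xs)")
    case True
    then have "count (mset (isolated xs)) p > 0"
      by (simp only: count_greater_zero_iff set_mset_mset)
    moreover have "count_below xs p = 1"
      using True by (simp add: isolated_def)
    moreover have "count (mset (isolated xs)) p \<le> count (mset xs) p"
      by (simp add: isolated_def)
    ultimately show ?thesis
      using True count_le_count_below[of xs p] by (simp only: if_True)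
  qed simp
  then show ?thesis
    by (simp add: distinct_count_atmost_1)
qed

text \<open>This form mentions only whether counts are 0 or 1, which is what survives truncation at
  2.\<close>

lemma set_isolated:
  "set (isolated xs) = {p. count_below xs p = 1 \<and> (\<forall>q. q \<subset> p \<longrightarrow> count_below xs q = 0)}"
proof (rule Set.set_eqI)
  fix p
  have single: "\<exists>r. filter (\<lambda>q. q \<subseteq> p) xs = [r]" if "count_below xs p = 1"
    using that by (simp add: count_below_def length_Suc_conv)
  have below: "q \<in> set (filter (\<lambda>q. q \<subseteq> p) xs) \<longleftrightarrow> q \<in> set xs \<and> q \<subseteq> p" for q
    by auto
  show "p \<in> set (isolated xs) \<longleftrightarrow>
      p \<in> {p. count_below xs p = 1 \<and> (\<forall>q. q \<subset> p \<longrightarrow> count_below xs q = 0)}"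
  proof (cases "count_below xs p = 1")
    case True
    then obtain r where r: "filter (\<lambda>q. q \<subseteq> p) xs = [r]"
      using single by blast
    have mem: "q \<in> set xs \<and> q \<subseteq> p \<longleftrightarrow> q = r" for q
      using below[of q] unfolding r by simp
    \<comment> \<open>The only entry inside \<open>p\<close> is \<open>r\<close>. Either
      \<open>r = p\<close>, or \<open>r\<close> is a proper subset of \<open>p\<close> whose count
      is nonzero.\<close>
    have "p \<in> set xs \<longleftrightarrow> (\<forall>q. q \<subset> p \<longrightarrow> count_below xs q = 0)"
    proof
      assume "p \<in> set xs"
      then have "r = p"
        using mem[of p] by simp
      then show "\<forall>q. q \<subset> p \<longrightarrow> count_below xs q = 0"
        unfolding count_below_eq_0_iff using mem by (metis order.trans psubset_eq subset_antisym)
    next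
      assume *: "\<forall>q. q \<subset> p \<longrightarrow> count_below xs q = 0"
      have "r \<in> set xs" "r \<subseteq> p"
        using mem[of r] by simp_all
      moreover from this have "count_below xs r \<noteq> 0"
        unfolding count_below_eq_0_iff by blast
      ultimately show "p \<in> set xs"
        using * by (metis psubsetI)
    qed
    then show ?thesis
      using True by (simp add: isolated_def)
  qed (simp add: isolated_def)
qed

lemma isolated_cong:
  assumes "\<And>Z. min 2 (count_below xs Z) = min 2 (count_below ys Z)"
  shows "set (isolated xs) = set (isolated ys)"
proof -
  have "count_below xs Z = k \<longleftrightarrow> count_below ys Z = k" if "k < 2" for Z k
    using assms[of Z] that by linarith
  then show ?thesis
    by (simp add: set_isolated)
qed

section \<open>Expansion of terms into sums of monomials\<close>

primrec monomials :: "'v sr_term \<Rightarrow> 'v set list" where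
  "monomials (Var v) = [{v}]"
| "monomials Zero = []"
| "monomials One = [{}]"
| "monomials (Add t u) = monomials t @ monomials u"
| "monomials (Mult t u) = concat (map (\<lambda>p. map ((\<union>) p) (monomials u)) (monomials t))"

lemma finite_monomials: "p \<in> set (monomials t) \<Longrightarrow> finite p"
  by (induction t arbitrary: p) auto

text \<open>Addition need not be idempotent, so repeated monomials matter and the index is a list
  rather than a set.\<close>

definition list_sum :: "('a, 'm) ring_scheme \<Rightarrow> ('i \<Rightarrow> 'a) \<Rightarrow> 'i list \<Rightarrow> 'a" where
  "list_sum R g xs = foldr (\<lambda>i s. g i \<oplus>\<^bsub>R\<^esub> s) xs \<zero>\<^bsub>R\<^esub>"

lemma list_sum_simps [simp]:
  "list_sum R g [] = \<zero>\<^bsub>R\<^esub>"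
  "list_sum R g (i # xs) = g i \<oplus>\<^bsub>R\<^esub> list_sum R g xs"
  by (simp_all add: list_sum_def)

context abelian_monoid
begin

lemma list_sum_closed [simp, intro]:
  "g \<in> set xs \<rightarrow> carrier G \<Longrightarrow> list_sum G g xs \<in> carrier G"
  by (induction xs) (auto simp: Pi_iff)

lemma list_sum_append:
  "g \<in> set xs \<rightarrow> carrier G \<Longrightarrow> g \<in> set ys \<rightarrow> carrier G \<Longrightarrow>
    list_sum G g (xs @ ys) = list_sum G g xs \<oplus> list_sum G g ys"
  by (induction xs) (auto simp: Pi_iff a_assoc)

lemma list_sum_filter:
  assumes "g \<in> set xs \<rightarrow> carrier G"
  shows "list_sum G g xs = list_sum G g (filter P xs) \<oplus> list_sum G g (filter (\<lambda>i. \<not> P i) xs)"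
  using assms
proof (induction xs)
  case (Cons i xs)
  then have "g i \<in> carrier G" "list_sum G g (filter P xs) \<in> carrier G"
    "list_sum G g (filter (\<lambda>i. \<not> P i) xs) \<in> carrier G"
    by (auto simp: Pi_iff)
  with Cons show ?case
    by (simp add: a_ac)
qed simp

lemma list_sum_distinct:
  "distinct xs \<Longrightarrow> g \<in> set xs \<rightarrow> carrier G \<Longrightarrow> list_sum G g xs = finsum G g (set xs)"
  by (induction xs) (auto simp: Pi_iff)

lemma list_sum_absorb:
  assumes "a \<in> carrier G" "g \<in> set xs \<rightarrow> carrier G"
    and "\<And>i. i \<in> set xs \<Longrightarrow> a \<oplus> g i = a"
  shows "a \<oplus> list_sum G g xs = a"
  using assms(2,3)
proof (induction xs)
  case (Cons i xs)
  then have "g i \<in> carrier G" "list_sum G g xs \<in> carrier G"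
    by auto
  with assms(1) Cons show ?case
    by (simp flip: a_assoc)
qed (simp add: assms(1))

end

context semiring
begin

lemma list_sum_map_mult:
  assumes "a \<in> carrier R" "g \<in> set ys \<rightarrow> carrier R"
    and "\<And>j. j \<in> set ys \<Longrightarrow> h (f j) = a \<otimes> g j"
  shows "list_sum R h (map f ys) = a \<otimes> list_sum R g ys"
  using assms(2,3) by (induction ys) (auto simp: assms(1) r_distr)

text \<open>Distributivity, row by row. In the application \<open>f\<close> is the union of
  monomials and \<open>g\<close> their evaluation.\<close>

lemma list_sum_concat_mult:
  assumes "g \<in> set xs \<rightarrow> carrier R" "g \<in> set ys \<rightarrow> carrier R"
    and "\<And>i j. i \<in> set xs \<Longrightarrow> j \<in> set ys \<Longrightarrow> g (f i j) = g i \<otimes> g j"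
  shows "list_sum R g (concat (map (\<lambda>i. map (f i) ys) xs)) = list_sum R g xs \<otimes> list_sum R g ys"
  using assms(1,3)
proof (induction xs)
  case (Cons i xs)
  have cl: "g i \<in> carrier R" "list_sum R g xs \<in> carrier R" "list_sum R g ys \<in> carrier R"
    using Cons.prems(1) assms(2) by auto
  have row: "list_sum R g (map (f i) ys) = g i \<otimes> list_sum R g ys"
    using Cons.prems assms(2) cl by (intro list_sum_map_mult) auto
  have "g \<in> set (map (f i) ys) \<rightarrow> carrier R"
    "g \<in> set (concat (map (\<lambda>i. map (f i) ys) xs)) \<rightarrow> carrier R"
    using Cons.prems assms(2) by (auto simp: Pi_iff)
  then show ?case
    using Cons cl by (simp add: list_sum_append row l_distr)
qed (use assms(2) in auto)

text \<open>The sum is a multiple of \<open>\<one>\<close>, and by the assumption these multiples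
  are constant from the second one on.\<close>

lemma list_sum_indicator:
  assumes "\<one> \<oplus> \<one> \<oplus> \<one> = \<one> \<oplus> \<one>"
  shows "list_sum R (\<lambda>p. if p \<subseteq> Z then \<one> else \<zero>) xs =
    (if count_below xs Z = 0 then \<zero> else if count_below xs Z = 1 then \<one> else \<one> \<oplus> \<one>)"
  using assms by (induction xs) (auto simp flip: a_assoc)

end

section \<open>Evaluation of monomials and terms\<close>

context comm_mult_idem_semiring
begin

text \<open>A variable in both sets contributes its square on the right, which idempotence reduces
  to the single factor on the left.\<close>

lemma finprod_Un_idem:
  assumes "finite p" "finite q" "\<And>v. \<rho> v \<in> carrier R"
  shows "finprod R \<rho> (p \<union> q) = finprod R \<rho> p \<otimes> finprod R \<rho> q"
  using assms(1)
proof (induction p)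
  case (insert v p)
  have cl: "finprod R \<rho> A \<in> carrier R" for A
    using assms(3) by auto
  have "finprod R \<rho> (insert v (p \<union> q)) = \<rho> v \<otimes> finprod R \<rho> (p \<union> q)"
  proof (cases "v \<in> p \<union> q")
    case True
    \<comment> \<open>Isolating the factor \<open>\<rho> v\<close> already present lets it absorb
      the new copy.\<close>
    then have "finprod R \<rho> (p \<union> q) = \<rho> v \<otimes> finprod R \<rho> (p \<union> q - {v})"
      using insert.hyps assms finprod_insert[of "p \<union> q - {v}" v \<rho>]
      by (simp add: insert_absorb Pi_iff)
    then show ?thesis
      using True assms(3) cl by (simp add: insert_absorb mult_idem flip: m_assoc)
  qed (use insert.hyps assms in auto)
  then show ?case
    using insert assms cl by (simp add: m_assoc Pi_iff)
qed (use assms in auto)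

lemma finprod_indicator:
  "finite p \<Longrightarrow> finprod R (\<lambda>v. if v \<in> Z then \<one> else \<zero>) p = (if p \<subseteq> Z then \<one> else \<zero>)"
proof (induction p rule: finite_induct)
  case (insert v p)
  then show ?case
    by (subst finprod_insert) auto
qed simp

lemma term_value_eq_list_sum:
  assumes "\<And>v. \<rho> v \<in> carrier R"
  shows "term_value R \<rho> t = list_sum R (finprod R \<rho>) (monomials t)"
proof (induction t)
  case (Add t u)
  then show ?case
    using assms by (simp add: list_sum_append Pi_iff)
next
  case (Mult t u)
  have "list_sum R (finprod R \<rho>) (monomials (Mult t u)) =
      list_sum R (finprod R \<rho>) (monomials t) \<otimes> list_sum R (finprod R \<rho>) (monomials u)"
    unfolding monomials.simps using assms
    by (intro list_sum_concat_mult finprod_Un_idem) (auto simp: finite_monomials)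
  with Mult show ?case
    by simp
qed (use assms in \<open>simp_all add: Pi_iff\<close>)

end

section \<open>Truncated counts and identities in the variety\<close>

context semiring_in_V
begin

lemma count_below_eq_of_identity:
  assumes "\<one> \<oplus> \<one> \<noteq> \<one>" and "R \<Turnstile> t \<approx> u"
  shows "min 2 (count_below (monomials t) Z) = min 2 (count_below (monomials u) Z)"
proof -
  let ?\<rho> = "\<lambda>v. if v \<in> Z then \<one> else \<zero>"
  \<comment> \<open>The defining identity at \<open>x = y = z = \<one>\<close>.\<close>
  have one3: "\<one> \<oplus> \<one> \<oplus> \<one> = \<one> \<oplus> \<one>"
    using V_identity[of \<one> \<one> \<one>] by simp
  have "\<one> \<noteq> \<zero>"
    using assms(1) by auto
  \<comment> \<open>If \<open>\<one> \<oplus> \<one>\<close> were \<open>\<zero>\<close>, then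
    \<open>one3\<close> would read \<open>\<one> = \<zero>\<close>.\<close>
  moreover have "\<one> \<oplus> \<one> \<noteq> \<zero>"
    using one3 \<open>\<one> \<noteq> \<zero>\<close> by auto
  moreover have "term_value R ?\<rho> s =
      (if count_below (monomials s) Z = 0 then \<zero>
       else if count_below (monomials s) Z = 1 then \<one> else \<one> \<oplus> \<one>)" for s
  proof -
    have "term_value R ?\<rho> s = list_sum R (finprod R ?\<rho>) (monomials s)"
      by (rule term_value_eq_list_sum) simp
    also have "\<dots> = list_sum R (\<lambda>p. if p \<subseteq> Z then \<one> else \<zero>) (monomials s)"
      unfolding list_sum_def
      by (intro foldr_cong refl) (simp add: finprod_indicator finite_monomials)
    finally show ?thesis
      by (simp only: list_sum_indicator[OF one3])
  qed
  moreover have "term_value R ?\<rho> t = term_value R ?\<rho> u"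
    using assms(2) unfolding satisfies_identity_def by simp
  ultimately show ?thesis
    using assms(1) by (auto simp: min_def split: if_splits)
qed

text \<open>Take two entries \<open>q\<close>, \<open>r\<close> contained in \<open>p\<close>,
  possibly equal as sets. Since \<open>q \<union> r \<union> p = p\<close>, the product of their
  three values is the value of \<open>p\<close>, so the defining identity with \<open>z\<close> the
  value of \<open>p\<close> absorbs it into the sum of the other two.\<close>

lemma absorb_monomial:
  assumes "\<And>v. \<rho> v \<in> carrier R" "\<And>q. q \<in> set xs \<Longrightarrow> finite q" "finite p"
    and "count_below xs p \<ge> 2"
  shows "list_sum R (finprod R \<rho>) xs \<oplus> finprod R \<rho> p = list_sum R (finprod R \<rho>) xs"
proof -
  let ?g = "finprod R \<rho>"
  have cl: "?g A \<in> carrier R" "list_sum R ?g ys \<in> carrier R" for A ys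
    using assms(1) by auto
  obtain q r zs where qr: "filter (\<lambda>p'. p' \<subseteq> p) xs = q # r # zs"
    using assms(4) unfolding count_below_def
    by (metis Suc_le_length_iff numeral_2_eq_2)
  then have "q \<in> set (filter (\<lambda>p'. p' \<subseteq> p) xs)" "r \<in> set (filter (\<lambda>p'. p' \<subseteq> p) xs)"
    by simp_all
  then have sub: "q \<subseteq> p" "r \<subseteq> p" "finite q" "finite r"
    using assms(2) by auto
  \<comment> \<open>All summands other than the chosen \<open>q\<close> and
    \<open>r\<close>.\<close>
  define s where "s = list_sum R ?g zs \<oplus> list_sum R ?g (filter (\<lambda>p'. \<not> p' \<subseteq> p) xs)"
  have s: "s \<in> carrier R"
    using cl by (simp add: s_def)
  have "list_sum R ?g xs = ?g q \<oplus> ?g r \<oplus> s"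
    using cl list_sum_filter[of ?g xs "\<lambda>p'. p' \<subseteq> p"] by (simp add: qr s_def a_assoc Pi_iff)
  moreover have "?g q \<otimes> ?g r \<otimes> ?g p = ?g p"
  proof -
    have "?g q \<otimes> ?g r \<otimes> ?g p = ?g (q \<union> r \<union> p)"
      using sub assms by (simp add: finprod_Un_idem)
    also have "q \<union> r \<union> p = p"
      using sub by auto
    finally show ?thesis .
  qed
  then have "?g q \<oplus> ?g r \<oplus> ?g p = ?g q \<oplus> ?g r"
    using V_identity[of "?g q" "?g r" "?g p"] cl by simp
  ultimately show ?thesis
    using cl s by (metis a_assoc a_comm a_closed)
qed

lemma list_sum_eq_of_count_below_eq:
  assumes \<rho>: "\<And>v. \<rho> v \<in> carrier R"
    and fin: "\<And>p. p \<in> set xs \<union> set ys \<Longrightarrow> finite p"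
    and eq: "\<And>Z. min 2 (count_below xs Z) = min 2 (count_below ys Z)"
  shows "list_sum R (finprod R \<rho>) xs = list_sum R (finprod R \<rho>) ys"
proof -
  let ?g = "finprod R \<rho>"
  let ?rest = "\<lambda>zs. filter (\<lambda>p. count_below zs p \<noteq> 1) zs"
  have g: "?g \<in> A \<rightarrow> carrier R" for A
    using \<rho> by auto
  have split: "list_sum R ?g zs = list_sum R ?g (isolated zs) \<oplus> list_sum R ?g (?rest zs)" for zs
    unfolding isolated_def by (rule list_sum_filter[OF g])
  \<comment> \<open>An entry counts itself, which rules out 0; being filtered rules out 1.\<close>
  have rest: "count_below zs p \<ge> 2" if "p \<in> set (?rest zs)" for p zs
    using that count_below_eq_0_iff[of zs p] by (cases "count_below zs p") auto
  have absorb: "list_sum R ?g zs \<oplus> list_sum R ?g (?rest ws) = list_sum R ?g zs"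
    if "\<And>Z. min 2 (count_below zs Z) = min 2 (count_below ws Z)"
      and "\<And>p. p \<in> set zs \<union> set ws \<Longrightarrow> finite p" for zs ws
  proof (rule list_sum_absorb)
    fix p assume p: "p \<in> set (?rest ws)"
    \<comment> \<open>Having count at least 2 is visible after truncation, so it passes from
      \<open>ws\<close> to \<open>zs\<close>.\<close>
    have "count_below zs p \<ge> 2"
      using rest[OF p] that(1)[of p] by simp
    then show "list_sum R ?g zs \<oplus> ?g p = list_sum R ?g zs"
      using p that(2) by (intro absorb_monomial \<rho>) auto
  qed (simp_all add: g list_sum_closed)
  have iso: "list_sum R ?g (isolated xs) = list_sum R ?g (isolated ys)"
    by (simp add: list_sum_distinct distinct_isolated g isolated_cong[OF eq])
  \<comment> \<open>Absorbing the other list's remainder brings both sums to a common form: the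
    shared isolated part plus both remainders.\<close>
  have "list_sum R ?g xs
      = list_sum R ?g (isolated xs) \<oplus> list_sum R ?g (?rest xs) \<oplus> list_sum R ?g (?rest ys)"
    using absorb[of xs ys] eq fin split[of xs] by simp
  also have "\<dots> = list_sum R ?g (isolated ys) \<oplus> list_sum R ?g (?rest ys) \<oplus> list_sum R ?g (?rest xs)"
    unfolding iso by (simp add: a_ac list_sum_closed g)
  also have "\<dots> = list_sum R ?g ys"
    using absorb[of ys xs] eq fin split[of ys] by (simp add: Un_commute)
  finally show ?thesis .
qed

end

theorem theorem4p1:
  fixes S :: "('a, 'm) ring_scheme"
    and n :: nat
    and t u :: "nat sr_term"
  assumes "semiring_in_V S"
    and "\<one>\<^bsub>S\<^esub> \<oplus>\<^bsub>S\<^esub> \<one>\<^bsub>S\<^esub> \<noteq> \<one>\<^bsub>S\<^esub>"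
    and "vars t \<subseteq> {1..n}"
    and "vars u \<subseteq> {1..n}"
    and "S \<Turnstile> t \<approx> u"
  shows "\<forall>T :: ('b, 'k) ring_scheme. semiring_in_V T \<longrightarrow> T \<Turnstile> t \<approx> u"
proof (intro allI impI)
  fix T :: "('b, 'k) ring_scheme"
  assume "semiring_in_V T"
  then interpret T: semiring_in_V T .
  show "T \<Turnstile> t \<approx> u"
    unfolding satisfies_identity_def
  proof (intro allI impI)
    fix \<rho> :: "nat \<Rightarrow> 'b"
    assume "\<forall>v. \<rho> v \<in> carrier T"
    then have \<rho>: "\<rho> v \<in> carrier T" for v
      by blast
    show "term_value T \<rho> t = term_value T \<rho> u"
      unfolding T.term_value_eq_list_sum[OF \<rho>]
      \<comment> \<open>Truncated counts depend only on the terms, so their equality, obtained in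
        \<open>S\<close>, is available in \<open>T\<close>.\<close>
      using semiring_in_V.count_below_eq_of_identity[OF assms(1,2,5)]
      by (intro T.list_sum_eq_of_count_below_eq \<rho>) (auto simp: finite_monomials)
  qed
qed

end
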